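(* Suppose $P$ is separable with probability $1-\mu$ by the ground-truth classifier $G^*$, i.e. $R^{\mathsf m}_{\mathcal B}(G^*;0)\le \mu$. Let $\overline a := \max_{i} P_i(\mathcal M(G_{pl}))$ and suppose that $\overline a < 1/3$ and that $P$ satisfies $(\overline a,\overline c)$-expansion for some $\overline c>3$. Put $c := \min(1/\overline a,\overline c)$ and let $\delta\in[0,\tfrac1c]$. Let $\hat G$ be a minimizer, over all models $G:\mathcal X\to[0,1]$, of $$L(G) := \frac{c+3}{c-1}\, L_{\mathsf m}(G,G_{pl}) + \frac{2c+2}{c-1}\, R^{\mathsf m}_{\mathcal B}(G;\delta) - \mathrm{Err}(G_{pl}).$$ Then $$\mathrm{Err}_{\mathsf m}(\hat G)\le \frac{4}{c-1}\,\mathrm{Err}(G_{pl}) + \frac{2c+2}{c-1}\,\mu .$$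
   Context: Setting: $\mathcal X\subseteq\mathbb R^d$ is the input space and $P$ is a probability distribution on $\mathcal X$ (all functions and sets are assumed measurable as needed). The task is binary classification: $G^*:\mathcal X\to\{0,1\}$ is the ground-truth classifier, $G_{pl}:\mathcal X\to\{0,1\}$ is a pseudolabeler, and a model is a function $G:\mathcal X\to[0,1]$. For $i\in\{0,1\}$, $P_i$ is the distribution $P$ conditioned on the $i$-th class $\{x: G^*(x)=i\}$. Neighbourhoods: fix a set $\mathcal T$ of transformations of $\mathcal X$ and a radius $r>0$. For $x\in\mathcal X$, $\mathcal B(x)=\{x' : \exists T\in\mathcal T,\ \|x'-T(x)\|<r\}$ and $\mathcal N(x)=\{x' : \mathcal B(x)\cap\mathcal B(x')\ne\emptyset\}$; for $V\subseteq\mathcal X$, $\mathcal N(V)=\bigcup_{x\in V}\mathcal N(x)$. Expansion: $P_i$ satisfies $(a,c)$-expansion if for all $V\subseteq\mathcal X$ with $P_i(V)\le a$ one has $P_i(\mathcal N(V))\ge\min\{c\,P_i(V),1\}$. $P$ satisfies $(a,c)$-expansion if every $P_i$ does. Loss and errors: for $G:\mathcal X\to[0,1]$ and $H:\mathcal X\to\{0,1\}$, $L_{\mathsf m}(G,H)=\mathbb E_{x\sim P}[H(x)(1-G(x))+(1-H(x))G(x)]$. $\mathrm{Err}_{\mathsf m}(G)=L_{\mathsf m}(G,G^* )$. $\mathcal M(G_{pl})=\{x: G_{pl}(x)\ne G^*(x)\}$ and $\mathrm{Err}(G_{pl})=P(\mathcal M(G_{pl}))=L_{\mathsf m}(G_{pl},G^*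 )$. Marginal consistency: $S^{\mathsf m}_{\mathcal B}(G;\delta)=\{x : \frac{G(x)}{G(x')}\ge 1-\delta \text{ and } \frac{1-G(x)}{1-G(x')}\ge 1-\delta\ \ \forall x'\in\mathcal B(x)\}$, where the inequalities are read as $G(x)\ge(1-\delta)G(x')$ and $1-G(x)\ge(1-\delta)(1-G(x'))$ (so that vanishing denominators cause no problem), and $R^{\mathsf m}_{\mathcal B}(G;\delta)=P\big(x\notin S^{\mathsf m}_{\mathcal B}(G;\delta)\big)$. Convention: $1/0=+\infty$. *)

theory Defs
  imports "HOL-Probability.Probability"
begin

(* Throughout, P is a probability measure whose space is the input set X, and functions on X
   are total functions of which only the values on X matter. *)

definition models :: "'a measure \<Rightarrow> ('a \<Rightarrow> real) set" where
  "models P = {G \<in> borel_measurable P. \<forall>x\<in>space P. 0 \<le> G x \<and> G x \<le> 1}"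

(* Labels are the real numbers 0 and 1, so that a classifier is in particular a model. *)
definition classifiers :: "'a measure \<Rightarrow> ('a \<Rightarrow> real) set" where
  "classifiers P = {H \<in> borel_measurable P. \<forall>x\<in>space P. H x \<in> {0, 1}}"

definition ball_nbhd ::
  "'a::euclidean_space set \<Rightarrow> ('a \<Rightarrow> 'a) set \<Rightarrow> real \<Rightarrow> 'a \<Rightarrow> 'a set" where
  "ball_nbhd X Ts r x = {x' \<in> X. \<exists>T\<in>Ts. norm (x' - T x) < r}"

definition nbhd ::
  "'a::euclidean_space set \<Rightarrow> ('a \<Rightarrow> 'a) set \<Rightarrow> real \<Rightarrow> 'a \<Rightarrow> 'a set" where
  "nbhd X Ts r x = {x' \<in> X. ball_nbhd X Ts r x \<inter> ball_nbhd X Ts r x' \<noteq> {}}"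

definition nbhd_set ::
  "'a::euclidean_space set \<Rightarrow> ('a \<Rightarrow> 'a) set \<Rightarrow> real \<Rightarrow> 'a set \<Rightarrow> 'a set" where
  "nbhd_set X Ts r V = (\<Union>x\<in>V. nbhd X Ts r x)"

(* uniform_measure P C is P conditioned on C: it maps A to P (C \<inter> A) / P C.
   If the class has probability zero, this is the zero measure. *)
definition class_dist :: "'a measure \<Rightarrow> ('a \<Rightarrow> real) \<Rightarrow> real \<Rightarrow> 'a measure" where
  "class_dist P Gstar i = uniform_measure P {x \<in> space P. Gstar x = i}"

definition dist_expansion ::
  "('a::euclidean_space \<Rightarrow> 'a) set \<Rightarrow> real \<Rightarrow> 'a measure \<Rightarrow> real \<Rightarrow> real \<Rightarrow> bool" where
  "dist_expansion Ts r Q a c \<longleftrightarrow>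
     (\<forall>V\<in>sets Q. measure Q V \<le> a \<longrightarrow>
        measure Q (nbhd_set (space Q) Ts r V) \<ge> min (c * measure Q V) 1)"

definition expansion ::
  "('a::euclidean_space \<Rightarrow> 'a) set \<Rightarrow> real \<Rightarrow> 'a measure \<Rightarrow> ('a \<Rightarrow> real) \<Rightarrow> real \<Rightarrow> real \<Rightarrow> bool" where
  "expansion Ts r P Gstar a c \<longleftrightarrow> (\<forall>i\<in>{0, 1}. dist_expansion Ts r (class_dist P Gstar i) a c)"

definition L_m :: "'a measure \<Rightarrow> ('a \<Rightarrow> real) \<Rightarrow> ('a \<Rightarrow> real) \<Rightarrow> real" where
  "L_m P G H = (\<integral>x. H x * (1 - G x) + (1 - H x) * G x \<partial>P)"

definition Err_m :: "'a measure \<Rightarrow> ('a \<Rightarrow> real) \<Rightarrow> ('a \<Rightarrow> real) \<Rightarrow> real" where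
  "Err_m P Gstar G = L_m P G Gstar"

definition mistakes :: "'a measure \<Rightarrow> ('a \<Rightarrow> real) \<Rightarrow> ('a \<Rightarrow> real) \<Rightarrow> 'a set" where
  "mistakes P Gstar Gpl = {x \<in> space P. Gpl x \<noteq> Gstar x}"

definition Err :: "'a measure \<Rightarrow> ('a \<Rightarrow> real) \<Rightarrow> ('a \<Rightarrow> real) \<Rightarrow> real" where
  "Err P Gstar Gpl = measure P (mistakes P Gstar Gpl)"

(* The ratio conditions G x / G x' \<ge> 1 - \<delta> etc. in multiplied-out form. *)
definition S_m ::
  "'a::euclidean_space set \<Rightarrow> ('a \<Rightarrow> 'a) set \<Rightarrow> real \<Rightarrow> ('a \<Rightarrow> real) \<Rightarrow> real \<Rightarrow> 'a set" where
  "S_m X Ts r G \<delta> = {x \<in> X. \<forall>x'\<in>ball_nbhd X Ts r x.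
     G x \<ge> (1 - \<delta>) * G x' \<and> 1 - G x \<ge> (1 - \<delta>) * (1 - G x')}"

definition R_m ::
  "('a::euclidean_space \<Rightarrow> 'a) set \<Rightarrow> real \<Rightarrow> 'a measure \<Rightarrow> ('a \<Rightarrow> real) \<Rightarrow> real \<Rightarrow> real" where
  "R_m Ts r P G \<delta> = measure P {x \<in> space P. x \<notin> S_m (space P) Ts r G \<delta>}"

definition objective ::
  "('a::euclidean_space \<Rightarrow> 'a) set \<Rightarrow> real \<Rightarrow> 'a measure \<Rightarrow> ('a \<Rightarrow> real) \<Rightarrow> ('a \<Rightarrow> real) \<Rightarrow>
   real \<Rightarrow> real \<Rightarrow> ('a \<Rightarrow> real) \<Rightarrow> real" where
  "objective Ts r P Gstar Gpl c \<delta> G =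
     (c + 3) / (c - 1) * L_m P G Gpl + (2 * c + 2) / (c - 1) * R_m Ts r P G \<delta> - Err P Gstar Gpl"

end

theory Submission
  imports Defs
begin

text \<open>
  Let \<open>f = \<bar>G - G\<^sup>*\<bar>\<close> be the pointwise error of a model \<open>G\<close>, \<open>M\<close> the set of mistakes of the
  pseudolabeler and \<open>S\<close> the set on which \<open>G\<close> is consistent. If \<open>x\<close> and \<open>y\<close> are neighbours in \<open>S\<close> of
  the same class, then \<open>f y \<ge> f x - \<delta>\<close>. Expansion applied to the level sets
  \<open>{x \<in> M \<inter> S. f x - \<delta> > t}\<close>, integrated over \<open>t\<close>, gives
  \<open>c \<integral>\<^bsub>M \<inter> S\<^esub> max 0 (f - \<delta>) \<le> \<integral>\<^bsub>S\<^esub> f + R\<close>. Since \<open>c \<ge> 3\<close> and \<open>c \<delta> \<le> 1\<close>, the pointwise bound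
  \<open>(c + 1) f \<le> 2 + 2 c max 0 (f - \<delta>) - 2 f\<close> turns this into the statement that the objective
  dominates the error of every model. It remains to evaluate the objective at \<open>G\<^sup>*\<close>.
\<close>

section \<open>Comparing integrals through their level sets\<close>

text \<open>Tonelli for the region \<open>0 \<le> t < w x\<close>: its slice at \<open>x\<close> has
  length \<open>w x\<close>, its slice at \<open>t\<close> is a level set. Where \<open>w\<close> is
  negative the slice is empty, in agreement with the truncation by \<open>ennreal\<close>.\<close>

lemma (in sigma_finite_measure) nn_integral_layer_cake:
  fixes w :: "'a \<Rightarrow> real"
  assumes [measurable]: "w \<in> borel_measurable M"
  shows "(\<integral>\<^sup>+x. ennreal (w x) \<partial>M) =
    (\<integral>\<^sup>+t. emeasure M {x \<in> space M. t < w x} * indicator {0..} t \<partial>lborel)"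
proof -
  interpret pair_sigma_finite lborel M ..
  have "(\<integral>\<^sup>+x. ennreal (w x) \<partial>M) = (\<integral>\<^sup>+x. (\<integral>\<^sup>+t. indicator {0..<w x} t \<partial>lborel) \<partial>M)"
  proof (rule nn_integral_cong)
    fix x
    have "(\<integral>\<^sup>+t. indicator {0..<w x} t \<partial>lborel) = emeasure lborel {0..<w x}"
      by (rule nn_integral_indicator) simp
    also have "\<dots> = ennreal (w x)"
      by (cases "0 \<le> w x") (auto simp: ennreal_neg)
    finally show "ennreal (w x) = (\<integral>\<^sup>+t. indicator {0..<w x} t \<partial>lborel)" ..
  qed
  \<comment> \<open>As a condition on the pair of \<open>x\<close> and \<open>t\<close>, the
    integrand is visibly jointly measurable, which \<open>Fubini'\<close> requires.\<close>
  also have "\<dots> = (\<integral>\<^sup>+x. (\<integral>\<^sup>+t. (if 0 \<le> t \<and> t < w x then 1 else 0) \<partial>lborel) \<partial>M)"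
    by (intro nn_integral_cong) (auto simp: indicator_def)
  also have "\<dots> = (\<integral>\<^sup>+t. (\<integral>\<^sup>+x. (if 0 \<le> t \<and> t < w x then 1 else 0) \<partial>M) \<partial>lborel)"
    by (rule Fubini') simp
  also have "\<dots> = (\<integral>\<^sup>+t. emeasure M {x \<in> space M. t < w x} * indicator {0..} t \<partial>lborel)"
  proof (rule nn_integral_cong)
    fix t :: real
    have "(\<integral>\<^sup>+x. (if 0 \<le> t \<and> t < w x then 1 else 0) \<partial>M) =
      (\<integral>\<^sup>+x. indicator {0..} t * indicator {x \<in> space M. t < w x} x \<partial>M)"
      by (intro nn_integral_cong) (auto simp: indicator_def)
    also have "\<dots> = indicator {0..} t * emeasure M {x \<in> space M. t < w x}"
      by (rule nn_integral_cmult_indicator) simp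
    finally show "(\<integral>\<^sup>+x. (if 0 \<le> t \<and> t < w x then 1 else 0) \<partial>M) =
      emeasure M {x \<in> space M. t < w x} * indicator {0..} t"
      by (simp add: mult.commute)
  qed
  finally show ?thesis .
qed

text \<open>Integrate the level set bound over \<open>t\<close>. Since \<open>u \<le> 1\<close>,
  only levels in [0,1) contribute on the left, so the additive error \<open>R\<close> is paid over
  an interval of length one.\<close>

lemma (in finite_measure) integral_le_if_level_sets_le:
  fixes u v :: "'a \<Rightarrow> real"
  assumes u: "u \<in> borel_measurable M" "\<And>x. x \<in> space M \<Longrightarrow> 0 \<le> u x \<and> u x \<le> 1"
    and v: "integrable M v" "\<And>x. x \<in> space M \<Longrightarrow> 0 \<le> v x"
    and c: "0 \<le> c" and R: "0 \<le> R"
    and level: "\<And>t. 0 \<le> t \<Longrightarrow> t < 1 \<Longrightarrow>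
      c * measure M {x \<in> space M. t < u x} \<le> measure M {x \<in> space M. t < v x} + R"
  shows "c * (\<integral>x. u x \<partial>M) \<le> (\<integral>x. v x \<partial>M) + R"
proof -
  have [measurable]: "u \<in> borel_measurable M" "v \<in> borel_measurable M"
    using u v by auto
  have iu: "integrable M u"
    by (rule integrable_const_bound[where B = 1]) (use u in auto)
  \<comment> \<open>The bound is extended to all real \<open>t\<close>: below 0 both sides vanish,
    and from 1 on the level set of \<open>u\<close> is empty.\<close>
  have 1: "ennreal c * (emeasure M {x \<in> space M. t < u x} * indicator {0..} t)
    \<le> emeasure M {x \<in> space M. t < v x} * indicator {0..} t + ennreal R * indicator {0..<1} t" for t
  proof (cases "0 \<le> t \<and> t < 1")
    case True
    have "ennreal c * emeasure M {x \<in> space M. t < u x} =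
      ennreal (c * measure M {x \<in> space M. t < u x})"
      using c by (simp add: emeasure_eq_measure ennreal_mult)
    also have "\<dots> \<le> ennreal (measure M {x \<in> space M. t < v x} + R)"
      using level[of t] True by (intro ennreal_leI) auto
    also have "\<dots> = emeasure M {x \<in> space M. t < v x} + ennreal R"
      using R by (simp add: emeasure_eq_measure)
    finally show ?thesis using True by simp
  next
    case False
    have "emeasure M {x \<in> space M. t < u x} = 0" if "1 \<le> t"
      using u(2) that by (intro emeasure_eq_0_AE AE_I2) force
    then show ?thesis
      using False by (cases "t < 0") (simp_all add: not_less)
  qed
  have "ennreal c * (\<integral>\<^sup>+x. ennreal (u x) \<partial>M) =
    (\<integral>\<^sup>+t. ennreal c * (emeasure M {x \<in> space M. t < u x} * indicator {0..} t) \<partial>lborel)"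
    unfolding nn_integral_layer_cake[OF u(1)] by (subst nn_integral_cmult) auto
  also have "\<dots> \<le> (\<integral>\<^sup>+t. emeasure M {x \<in> space M. t < v x} * indicator {0..} t
      + ennreal R * indicator {0..<1} t \<partial>lborel)"
    by (intro nn_integral_mono 1)
  also have "\<dots> = (\<integral>\<^sup>+x. ennreal (v x) \<partial>M) + (\<integral>\<^sup>+t. ennreal R * indicator {0..<1::real} t \<partial>lborel)"
    by (subst nn_integral_add) (auto simp: nn_integral_layer_cake)
  also have "(\<integral>\<^sup>+t. ennreal R * indicator {0..<1::real} t \<partial>lborel) = ennreal R"
    by (subst nn_integral_cmult_indicator) auto
  also have "(\<integral>\<^sup>+x. ennreal (u x) \<partial>M) = ennreal (\<integral>x. u x \<partial>M)"
    by (rule nn_integral_eq_integral) (use iu u in auto)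
  also have "(\<integral>\<^sup>+x. ennreal (v x) \<partial>M) = ennreal (\<integral>x. v x \<partial>M)"
    by (rule nn_integral_eq_integral) (use v in auto)
  finally have "ennreal (c * (\<integral>x. u x \<partial>M)) \<le> ennreal ((\<integral>x. v x \<partial>M) + R)"
    using c R u v by (simp add: ennreal_mult[symmetric] ennreal_plus[symmetric] integral_nonneg_AE
        del: ennreal_plus)
  then show ?thesis
    using R v by (subst (asm) ennreal_le_iff) (auto intro!: add_nonneg_nonneg integral_nonneg_AE)
qed

section \<open>Pointwise error and expansion within one class\<close>

text \<open>For labels in {0,1} this is the distance between \<open>G x\<close> and
  \<open>H x\<close>. The affine form is the integrand of \<open>L_m\<close>, with the label
  function as first argument.\<close>

definition pointwise_error :: "('a \<Rightarrow> real) \<Rightarrow> ('a \<Rightarrow> real) \<Rightarrow> 'a \<Rightarrow> real" where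
  "pointwise_error H G x = H x * (1 - G x) + (1 - H x) * G x"

lemma L_m_eq: "L_m P G H = (\<integral>x. pointwise_error H G x \<partial>P)"
  by (simp add: L_m_def pointwise_error_def)

text \<open>Let \<open>z\<close> lie in both balls. Consistency at \<open>x\<close> and at
  \<open>y\<close> puts \<open>G x\<close> and \<open>G y\<close> into the same interval of length
  \<open>\<delta>\<close>, from \<open>(1 - \<delta>) * G z\<close> to
  \<open>(1 - \<delta>) * G z + \<delta>\<close>. With equal labels the errors then differ by at
  most \<open>\<delta>\<close>.\<close>

lemma pointwise_error_le_neighbour:
  assumes "x \<in> S_m X Ts r G \<delta>" "y \<in> S_m X Ts r G \<delta>" "y \<in> nbhd X Ts r x"
    and "H x = H y" "H x \<in> {0, 1}"
  shows "pointwise_error H G x - \<delta> \<le> pointwise_error H G y"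
proof -
  obtain z where z: "z \<in> ball_nbhd X Ts r x" "z \<in> ball_nbhd X Ts r y"
    using assms(3) by (auto simp: nbhd_def)
  have "(1 - \<delta>) * G z \<le> G x" "(1 - \<delta>) * (1 - G z) \<le> 1 - G x"
    "(1 - \<delta>) * G z \<le> G y" "(1 - \<delta>) * (1 - G z) \<le> 1 - G y"
    using z assms(1,2) by (auto simp: S_m_def)
  then have "G x - \<delta> \<le> G y" "G y - \<delta> \<le> G x"
    by (auto simp: algebra_simps)
  then show ?thesis
    using assms(4,5) by (auto simp: pointwise_error_def)
qed

text \<open>The multiplied-out form of conditional probability also covers a class of probability
  zero, where both sides vanish.\<close>

lemma (in finite_measure) measure_class_dist:
  assumes "{x \<in> space M. H x = i} \<in> sets M" "B \<in> sets M"
  shows "measure (class_dist M H i) B * measure M {x \<in> space M. H x = i} =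
    measure M ({x \<in> space M. H x = i} \<inter> B)"
proof (cases "measure M {x \<in> space M. H x = i} = 0")
  case True
  have "measure M ({x \<in> space M. H x = i} \<inter> B) \<le> measure M {x \<in> space M. H x = i}"
    by (intro finite_measure_mono) (use assms in auto)
  then show ?thesis
    using True by (simp add: antisym)
next
  case False
  then have "emeasure M {x \<in> space M. H x = i} \<noteq> 0"
    by (simp add: emeasure_eq_measure)
  then show ?thesis
    unfolding class_dist_def using False assms
    by (subst measure_uniform_measure) auto
qed

text \<open>As a subset of \<open>A\<close>, the set \<open>V\<close> is small enough for expansion.
  Moreover \<open>c * a \<le> 1\<close> keeps \<open>c\<close> times its conditional measure below
  the cap 1 in the minimum. Multiplying by the probability of the class returns to
  \<open>M\<close>.\<close>

lemma expansion_of_class: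
  fixes M :: "'a::euclidean_space measure"
  assumes M: "finite_measure M" and C: "{x \<in> space M. H x = i} \<in> sets M"
    and V: "V \<in> sets M" "V \<subseteq> {x \<in> space M. H x = i}" "V \<subseteq> A" "A \<in> sets M"
    and N: "nbhd_set (space M) Ts r V \<in> sets M"
    and expansion: "dist_expansion Ts r (class_dist M H i) a c'"
    and a: "measure (class_dist M H i) A \<le> a" and c: "c * a \<le> 1" "c \<le> c'" "0 \<le> c"
  shows "c * measure M V \<le> measure M ({x \<in> space M. H x = i} \<inter> nbhd_set (space M) Ts r V)"
proof -
  interpret finite_measure M by fact
  let ?Q = "class_dist M H i" and ?C = "{x \<in> space M. H x = i}"
  have [simp]: "sets ?Q = sets M" "space ?Q = space M"
    by (simp_all add: class_dist_def)
  have "measure ?Q V * measure M ?C \<le> measure ?Q A * measure M ?C"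
    unfolding measure_class_dist[OF C V(1)] measure_class_dist[OF C V(4)]
    by (intro finite_measure_mono) (use V C in auto)
  \<comment> \<open>Cancelling the class probability leaves the case of a null class, in which
    \<open>V\<close> is null and the claim is trivial.\<close>
  then have "measure ?Q V \<le> a \<or> measure M ?C = 0"
    using a by (auto simp: mult_le_cancel_right less_le)
  moreover have VC: "measure M V = measure ?Q V * measure M ?C"
    unfolding measure_class_dist[OF C V(1)] using V(2) by (simp add: Int_absorb1)
  moreover have ?thesis if le: "measure ?Q V \<le> a"
  proof -
    have "c * measure ?Q V \<le> c * a" "c * measure ?Q V \<le> c' * measure ?Q V"
      using le c by (auto intro: mult_left_mono mult_right_mono)
    then have "c * measure ?Q V \<le> min (c' * measure ?Q V) 1"
      using c by simp
    also have "\<dots> \<le> measure ?Q (nbhd_set (space M) Ts r V)"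
      using expansion V(1) le by (auto simp: dist_expansion_def)
    finally have "c * measure ?Q V * measure M ?C
      \<le> measure ?Q (nbhd_set (space M) Ts r V) * measure M ?C"
      by (rule mult_right_mono) simp
    then show ?thesis
      using VC measure_class_dist[OF C N] by (simp add: mult.assoc)
  qed
  ultimately show ?thesis by auto
qed

lemma classifiers_subset_models: "classifiers P \<subseteq> models P"
  by (force simp: classifiers_def models_def)

lemma pointwise_error_bounds:
  assumes "H \<in> classifiers P" "G \<in> models P" "x \<in> space P"
  shows "0 \<le> pointwise_error H G x" "pointwise_error H G x \<le> 1"
  using assms by (force simp: classifiers_def models_def pointwise_error_def)+

lemma (in finite_measure) integrable_pointwise_error:
  assumes "H \<in> classifiers M" "G \<in> models M"
  shows "integrable M (pointwise_error H G)"
proof (rule integrable_const_bound[where B = 1])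
  show "AE x in M. norm (pointwise_error H G x) \<le> 1"
    using pointwise_error_bounds[OF assms] by auto
  have [measurable]: "H \<in> borel_measurable M" "G \<in> borel_measurable M"
    using assms by (auto simp: classifiers_def models_def)
  show "pointwise_error H G \<in> borel_measurable M"
    unfolding pointwise_error_def by measurable
qed

section \<open>Expansion of the consistent mistakes\<close>

text \<open>Each level set on the left splits by class into \<open>V 0\<close> and
  \<open>V 1\<close>, and each part expands within its class. The neighbours reached either lie in
  \<open>S\<close> and have error above the level, or lie outside \<open>S\<close> and are paid for
  by \<open>R_m\<close>.\<close>

lemma consistent_mistakes_expansion:
  fixes M :: "'a::euclidean_space measure"
  assumes M: "finite_measure M" and H: "H \<in> classifiers M" and G: "G \<in> models M" and A: "A \<in> sets M"
    and S: "S_m (space M) Ts r G \<delta> \<in> sets M" and \<delta>: "0 \<le> \<delta>"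
    and N: "\<And>V. V \<in> sets M \<Longrightarrow> nbhd_set (space M) Ts r V \<in> sets M"
    and expansion: "expansion Ts r M H a c'"
    and a: "\<And>i. i \<in> {0, 1} \<Longrightarrow> measure (class_dist M H i) A \<le> a"
    and c: "c * a \<le> 1" "c \<le> c'" "0 \<le> c"
  defines "f \<equiv> pointwise_error H G" and "S \<equiv> S_m (space M) Ts r G \<delta>"
  shows "c * (\<integral>x. indicator (A \<inter> S) x * max 0 (f x - \<delta>) \<partial>M)
    \<le> (\<integral>x. indicator S x * f x \<partial>M) + R_m Ts r M G \<delta>"
proof -
  interpret finite_measure M by fact
  show ?thesis
  proof (rule integral_le_if_level_sets_le)
    have intf: "integrable M f"
      unfolding f_def using H G by (rule integrable_pointwise_error)
    then have [measurable]: "f \<in> borel_measurable M" by simp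
    have [measurable]: "H \<in> borel_measurable M" "A \<in> sets M" "S \<in> sets M"
      using H A S by (auto simp: classifiers_def S_def)
    have f: "0 \<le> f x" "f x \<le> 1" if "x \<in> space M" for x
      using pointwise_error_bounds[OF H G that] by (auto simp: f_def)
    show "(\<lambda>x. indicator (A \<inter> S) x * max 0 (f x - \<delta>)) \<in> borel_measurable M"
      by measurable
    show "integrable M (\<lambda>x. indicator S x * f x)"
      using integrable_mult_indicator[OF \<open>S \<in> sets M\<close> intf] by simp
    show "0 \<le> indicator (A \<inter> S) x * max 0 (f x - \<delta>) \<and> indicator (A \<inter> S) x * max 0 (f x - \<delta>) \<le> 1"
      if "x \<in> space M" for x
      using f[OF that] \<delta> by (auto simp: indicator_def)
    show "0 \<le> indicator S x * f x" if "x \<in> space M" for x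
      using f[OF that] by (auto simp: indicator_def)
    show "0 \<le> c" "0 \<le> R_m Ts r M G \<delta>"
      using c by (auto simp: R_m_def)
    fix t :: real
    assume t: "0 \<le> t" "t < 1"
    define C where "C i = {x \<in> space M. H x = i}" for i
    define V where "V i = {x \<in> space M. x \<in> A \<and> x \<in> S \<and> H x = i \<and> t < f x - \<delta>}" for i
    \<comment> \<open>Intersecting with the class makes \<open>E 0\<close> and \<open>E 1\<close>
      disjoint, and gives neighbours the label of the points of \<open>V i\<close>.\<close>
    define E where "E i = C i \<inter> nbhd_set (space M) Ts r (V i)" for i
    have Cs [measurable]: "C i \<in> sets M" for i
      unfolding C_def by measurable
    have Vs [measurable]: "V i \<in> sets M" for i
      unfolding V_def by measurable
    have Es [measurable]: "E i \<in> sets M" for i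
      unfolding E_def using N[OF Vs] Cs by blast
    have step: "c * measure M (V i) \<le> measure M (E i)" if "i \<in> {0, 1}" for i
      unfolding E_def C_def
      by (rule expansion_of_class[OF M _ _ _ _ A _ _ a[OF that] c])
        (use expansion that Vs N Cs in \<open>auto simp: V_def C_def expansion_def\<close>)
    \<comment> \<open>The shift by \<open>\<delta>\<close> in \<open>V i\<close> absorbs the loss
      between consistent neighbours: \<open>f y \<ge> f x - \<delta> > t\<close>.\<close>
    have Esub: "E i \<subseteq> {x \<in> space M. t < indicator S x * f x} \<union> {x \<in> space M. x \<notin> S}"
      if "i \<in> {0, 1}" for i
    proof
      fix y assume "y \<in> E i"
      then obtain x where x: "x \<in> V i" "y \<in> nbhd (space M) Ts r x" and y: "y \<in> space M" "H y = i"
        by (auto simp: E_def C_def nbhd_set_def)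
      have "t < f y" if "y \<in> S"
        using pointwise_error_le_neighbour[of x "space M" Ts r G \<delta> y H] x y that \<open>i \<in> {0, 1}\<close>
        by (auto simp: V_def S_def f_def)
      then show "y \<in> {x \<in> space M. t < indicator S x * f x} \<union> {x \<in> space M. x \<notin> S}"
        using y by auto
    qed
    \<comment> \<open>Because \<open>t \<ge> 0\<close>, exceeding \<open>t\<close> forces the
      indicator to be 1 and the maximum to be \<open>f x - \<delta>\<close>.\<close>
    have "{x \<in> space M. t < indicator (A \<inter> S) x * max 0 (f x - \<delta>)} = V 0 \<union> V 1"
      using H t by (auto simp: V_def indicator_def classifiers_def split: if_splits)
    moreover have "measure M (V 0 \<union> V 1) = measure M (V 0) + measure M (V 1)"
      by (rule finite_measure_Union) (auto simp: Vs, auto simp: V_def)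
    ultimately have "c * measure M {x \<in> space M. t < indicator (A \<inter> S) x * max 0 (f x - \<delta>)}
      = c * measure M (V 0) + c * measure M (V 1)"
      by (simp add: distrib_left)
    also have "\<dots> \<le> measure M (E 0) + measure M (E 1)"
      by (intro add_mono step) auto
    also have "\<dots> = measure M (E 0 \<union> E 1)"
      by (rule finite_measure_Union[symmetric]) (auto simp: Es, auto simp: E_def C_def)
    also have "\<dots> \<le> measure M ({x \<in> space M. t < indicator S x * f x} \<union> {x \<in> space M. x \<notin> S})"
      using Esub by (intro finite_measure_mono) auto
    also have "\<dots> \<le> measure M {x \<in> space M. t < indicator S x * f x} + measure M {x \<in> space M. x \<notin> S}"
      by (intro measure_Un_le) auto
    finally show "c * measure M {x \<in> space M. t < indicator (A \<inter> S) x * max 0 (f x - \<delta>)}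
      \<le> measure M {x \<in> space M. t < indicator S x * f x} + R_m Ts r M G \<delta>"
      by (simp add: R_m_def S_def)
  qed
qed

section \<open>The objective dominates the error of every model\<close>

text \<open>Split integrals along the mistakes \<open>A\<close>. Error and loss differ only in that
  the loss counts \<open>1 - f\<close> on \<open>A\<close>, so the claim reduces to an upper bound
  for \<open>I A\<close>, supplied by expansion.\<close>

lemma Err_m_le_objective:
  fixes M :: "'a::euclidean_space measure"
  assumes M: "finite_measure M" and H: "H \<in> classifiers M" and K: "K \<in> classifiers M" and G: "G \<in> models M"
    and S: "S_m (space M) Ts r G \<delta> \<in> sets M" and \<delta>: "0 \<le> \<delta>" "c * \<delta> \<le> 1"
    and N: "\<And>V. V \<in> sets M \<Longrightarrow> nbhd_set (space M) Ts r V \<in> sets M"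
    and expansion: "expansion Ts r M H a c'"
    and a: "\<And>i. i \<in> {0, 1} \<Longrightarrow> measure (class_dist M H i) (mistakes M H K) \<le> a"
    and c: "c * a \<le> 1" "c \<le> c'" "3 \<le> c"
  shows "Err_m M H G \<le> objective Ts r M H K c \<delta> G"
proof -
  interpret finite_measure M by fact
  define f where "f = pointwise_error H G"
  define S where "S = S_m (space M) Ts r G \<delta>"
  define A where "A = mistakes M H K"
  define R where "R = R_m Ts r M G \<delta>"
  define I where "I B = (\<integral>x. indicator B x * f x \<partial>M)" for B
  have intf: "integrable M f"
    unfolding f_def using H G by (rule integrable_pointwise_error)
  have [measurable]: "H \<in> borel_measurable M" "K \<in> borel_measurable M" "S \<in> sets M"
    using H K S by (auto simp: classifiers_def S_def)
  have A [measurable]: "A \<in> sets M"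
    unfolding A_def mistakes_def by measurable
  have f: "0 \<le> f x" "f x \<le> 1" if "x \<in> space M" for x
    using pointwise_error_bounds[OF H G that] by (auto simp: f_def)
  have int_ind: "integrable M (\<lambda>x. indicator B x * g x)" 
    if "B \<in> sets M" "integrable M g" for B and g :: "'a \<Rightarrow> real"
    using integrable_mult_indicator[OF that] by simp
  have intm: "integrable M (\<lambda>x. max 0 (f x - \<delta>))"
    using intf by (intro integrable_max) auto
  have R: "R = measure M (space M - S)"
    by (simp add: R_def R_m_def S_def set_diff_eq)
  have expand: "c * (\<integral>x. indicator (A \<inter> S) x * max 0 (f x - \<delta>) \<partial>M) \<le> I S + R"
    unfolding I_def R_def f_def S_def A_def
    by (rule consistent_mistakes_expansion[OF M H G _ S \<delta>(1) N expansion a])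
      (use A c in \<open>auto simp: A_def\<close>)
  \<comment> \<open>Four cases: on \<open>A \<inter> S\<close> this is fact 1, on \<open>A\<close>
    outside \<open>S\<close> it is fact 2, and off \<open>A\<close> it follows from
    \<open>0 \<le> f x\<close> and \<open>1 \<le> c\<close>. The term with \<open>S\<close> on the
    left is there to cancel \<open>I S\<close> from \<open>expand\<close>.\<close>
  have pointwise: "(c + 1) * (indicator A x * f x) + 2 * (indicator S x * f x)
    \<le> 2 * indicator A x + 2 * c * (indicator (A \<inter> S) x * max 0 (f x - \<delta>))
      + 2 * (indicator (space M - A) x * f x) + (c - 1) * indicator (space M - S) x"
    if x: "x \<in> space M" for x
  proof -
    \<comment> \<open>If \<open>f x \<le> \<delta>\<close>, then
      \<open>(c + 3) * \<delta> \<le> 2 * c * \<delta> \<le> 2\<close>. Otherwise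
      \<open>c + 3 \<le> 2 * c\<close>, and subtracting \<open>\<delta>\<close> costs at most
      2.\<close>
    have 1: "(c + 3) * f x \<le> 2 + 2 * c * max 0 (f x - \<delta>)"
    proof (cases "f x \<le> \<delta>")
      case True
      have "(c + 3) * f x \<le> (c + 3) * \<delta>" "3 * \<delta> \<le> c * \<delta>"
        using True c \<delta> by (auto intro: mult_left_mono mult_right_mono)
      then have "(c + 3) * f x \<le> 2"
        using \<delta> by (simp add: algebra_simps)
      then show ?thesis using True by simp
    next
      case False
      have "3 * f x \<le> c * f x"
        using f[OF x] c by (intro mult_right_mono) auto
      moreover have "2 * c * (f x - \<delta>) \<ge> 2 * (c * f x) - 2"
        using \<delta> by (simp add: algebra_simps)
      ultimately show ?thesis using False by (simp add: algebra_simps)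
    qed
    have 2: "(c + 1) * f x \<le> c + 1"
      using f[OF x] c by (intro mult_left_le) auto
    show ?thesis
      using 1 2 f[OF x] x c by (auto simp: indicator_def algebra_simps)
  qed
  have "(c + 1) * I A + 2 * I S =
    (\<integral>x. (c + 1) * (indicator A x * f x) + 2 * (indicator S x * f x) \<partial>M)"
    unfolding I_def using intf int_ind by simp
  also have "\<dots> \<le> (\<integral>x. 2 * indicator A x + 2 * c * (indicator (A \<inter> S) x * max 0 (f x - \<delta>))
      + 2 * (indicator (space M - A) x * f x) + (c - 1) * indicator (space M - S) x \<partial>M)"
    by (intro integral_mono pointwise Bochner_Integration.integrable_add integrable_mult_right
        int_ind intf intm integrable_real_indicator) (auto simp: less_top[symmetric])
  also have "\<dots> = 2 * measure M A + 2 * c * (\<integral>x. indicator (A \<inter> S) x * max 0 (f x - \<delta>) \<partial>M)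
      + 2 * I (space M - A) + (c - 1) * R"
  proof -
    have "A \<inter> space M = A" "(space M - S) \<inter> space M = space M - S"
      using sets.sets_into_space[OF A] by auto
    then show ?thesis
      unfolding I_def R
      using int_ind[OF _ intf, of "space M - A"] int_ind[OF _ intm, of "A \<inter> S"]
      by (simp add: less_top[symmetric])
  qed
  \<comment> \<open>Twice \<open>expand\<close> is inserted: \<open>2 * I S\<close> cancels, and the
    added \<open>2 * R\<close> turns the factor \<open>c - 1\<close> into
    \<open>c + 1\<close>.\<close>
  finally have key: "(c + 1) * I A \<le> 2 * measure M A + 2 * I (space M - A) + (c + 1) * R"
    using expand by (simp add: algebra_simps)
  have "Err_m M H G = (\<integral>x. indicator A x * f x + indicator (space M - A) x * f x \<partial>M)"
    unfolding Err_m_def L_m_eq f_def[symmetric]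
    by (intro Bochner_Integration.integral_cong) (auto simp: indicator_def)
  also have "\<dots> = I A + I (space M - A)"
    unfolding I_def using intf int_ind by simp
  finally have err: "Err_m M H G = I A + I (space M - A)" .
  have "L_m M G K = (\<integral>x. indicator A x - indicator A x * f x + indicator (space M - A) x * f x \<partial>M)"
    unfolding L_m_eq
  proof (rule Bochner_Integration.integral_cong[OF refl])
    fix x assume x: "x \<in> space M"
    then have "H x = 0 \<or> H x = 1" "K x = 0 \<or> K x = 1"
      using H K by (auto simp: classifiers_def)
    \<comment> \<open>On \<open>A\<close> the two binary labels are opposite, so the error against
      \<open>K\<close> is \<open>1 - f x\<close>; elsewhere they agree.\<close>
    then show "pointwise_error K G x =
      indicator A x - indicator A x * f x + indicator (space M - A) x * f x"
      using x by (auto simp: A_def mistakes_def f_def pointwise_error_def indicator_def)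
  qed
  also have "\<dots> = measure M A - I A + I (space M - A)"
    unfolding I_def using intf int_ind sets.sets_into_space[OF A]
    by (simp add: less_top[symmetric] Int_absorb2)
  finally have loss: "L_m M G K = measure M A - I A + I (space M - A)" .
  \<comment> \<open>The difference of the two sides is exactly twice that of \<open>key\<close>;
    this fixes the coefficients of the objective.\<close>
  have "(c - 1) * Err_m M H G + (c - 1) * measure M A \<le> (c + 3) * L_m M G K + (2 * c + 2) * R"
    unfolding err loss using key by (simp add: algebra_simps)
  then have "Err_m M H G + measure M A \<le> ((c + 3) * L_m M G K + (2 * c + 2) * R) / (c - 1)"
    using c by (simp add: pos_le_divide_eq algebra_simps)
  then show ?thesis
    unfolding objective_def Err_def A_def R_def
    by (simp add: add_divide_distrib distrib_right)
qed

section \<open>Comparing the minimizer with the ground truth\<close>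

text \<open>Lowering the factor \<open>1 - \<delta>\<close> weakens both conditions, as
  \<open>G\<close> and \<open>1 - G\<close> are nonnegative on the balls, which lie in
  \<open>X\<close>. This carries separability from parameter 0 to \<open>\<delta>\<close>.\<close>

lemma S_m_mono:
  assumes "\<delta> \<le> \<delta>'" "\<And>x. x \<in> X \<Longrightarrow> 0 \<le> G x \<and> G x \<le> 1"
  shows "S_m X Ts r G \<delta> \<subseteq> S_m X Ts r G \<delta>'"
proof
  fix x assume x: "x \<in> S_m X Ts r G \<delta>"
  have "(1 - \<delta>') * G y \<le> G x \<and> (1 - \<delta>') * (1 - G y) \<le> 1 - G x"
    if y: "y \<in> ball_nbhd X Ts r x" for y
  proof -
    have "0 \<le> G y \<and> G y \<le> 1"
      using assms(2) y by (auto simp: ball_nbhd_def)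
    then have "(1 - \<delta>') * G y \<le> (1 - \<delta>) * G y" "(1 - \<delta>') * (1 - G y) \<le> (1 - \<delta>) * (1 - G y)"
      using assms(1) by (auto intro: mult_right_mono)
    then show ?thesis
      using x y by (force simp: S_m_def)
  qed
  then show "x \<in> S_m X Ts r G \<delta>'"
    using x by (auto simp: S_m_def)
qed

lemma (in finite_measure) L_m_eq_Err:
  assumes H: "H \<in> classifiers M" and K: "K \<in> classifiers M"
  shows "L_m M H K = Err M H K"
proof -
  have [measurable]: "H \<in> borel_measurable M" "K \<in> borel_measurable M"
    using H K by (auto simp: classifiers_def)
  have "L_m M H K = (\<integral>x. indicator (mistakes M H K) x \<partial>M)"
    unfolding L_m_def
  proof (rule Bochner_Integration.integral_cong[OF refl])
    fix x assume x: "x \<in> space M"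
    then have "H x = 0 \<or> H x = 1" "K x = 0 \<or> K x = 1"
      using H K by (auto simp: classifiers_def)
    then show "K x * (1 - H x) + (1 - K x) * H x = indicator (mistakes M H K) x"
      using x by (auto simp: mistakes_def indicator_def)
  qed
  also have "\<dots> = measure M (mistakes M H K)"
    by (simp add: mistakes_def Int_absorb2)
  finally show ?thesis by (simp add: Err_def)
qed

theorem theorem2:
  fixes X :: "'a::euclidean_space set"
    and P :: "'a measure"
    and Ts :: "('a \<Rightarrow> 'a) set"
    and r \<mu> abar cbar c \<delta> :: real
    and Gstar Gpl Ghat :: "'a \<Rightarrow> real"
  assumes prob: "prob_space P" "sets P = sets (restrict_space borel X)"
    and transformations: "\<And>T. T \<in> Ts \<Longrightarrow> T \<in> X \<rightarrow> X"
    and radius: "r > 0"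
    and Gstar: "Gstar \<in> classifiers P"
    and Gpl: "Gpl \<in> classifiers P"
    and measurable_N: "\<And>V. V \<in> sets P \<Longrightarrow> nbhd_set X Ts r V \<in> sets P"
    and measurable_S: "\<And>G \<delta>'. G \<in> models P \<Longrightarrow> 0 \<le> \<delta>' \<Longrightarrow> \<delta>' \<le> 1 \<Longrightarrow> S_m X Ts r G \<delta>' \<in> sets P"
    and separable: "R_m Ts r P Gstar 0 \<le> \<mu>"
    and abar: "abar = (MAX i\<in>{0, 1}. measure (class_dist P Gstar i) (mistakes P Gstar Gpl))"
    and abar_less: "abar < 1 / 3"
    and cbar: "cbar > 3"
    and expansion: "expansion Ts r P Gstar abar cbar"
    and c: "c = (if abar = 0 then cbar else min (1 / abar) cbar)"
    and \<delta>: "0 \<le> \<delta>" "\<delta> \<le> 1 / c"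
    and minimizer: "is_arg_min (objective Ts r P Gstar Gpl c \<delta>) (\<lambda>G. G \<in> models P) Ghat"
  shows "Err_m P Gstar Ghat \<le> 4 / (c - 1) * Err P Gstar Gpl + (2 * c + 2) / (c - 1) * \<mu>"
proof -
  interpret prob_space P by fact
  have X: "space P = X"
    using sets_eq_imp_space_eq[OF prob(2)] by (simp add: space_restrict_space)
  have le_abar: "measure (class_dist P Gstar i) (mistakes P Gstar Gpl) \<le> abar" if "i \<in> {0, 1}" for i
    unfolding abar using that by (intro Max_ge) auto
  have abar0: "0 \<le> abar"
    using le_abar[of 0] by (auto intro: order_trans[OF measure_nonneg])
  \<comment> \<open>In HOL \<open>1 / 0 = 0\<close>, so the convention of an infinite quotient is
    realized by the separate case \<open>c = cbar\<close>. Otherwise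
    \<open>1 / abar > 3\<close>.\<close>
  have c3: "3 < c"
    using abar_less cbar abar0 unfolding c by (auto simp: field_simps)
  have ca: "c * abar \<le> 1"
    using abar0 unfolding c by (auto simp: field_simps min_def)
  have cc: "c \<le> cbar"
    unfolding c by auto
  have c\<delta>: "c * \<delta> \<le> 1"
    using \<delta> c3 by (simp add: field_simps)
  have \<delta>1: "\<delta> \<le> 1"
    using c3 by (intro order_trans[OF \<delta>(2)]) simp
  have Gs: "Gstar \<in> models P" and Gh: "Ghat \<in> models P"
    using Gstar classifiers_subset_models minimizer by (auto simp: is_arg_min_def)
  have "Err_m P Gstar Ghat \<le> objective Ts r P Gstar Gpl c \<delta> Ghat"
    by (rule Err_m_le_objective[OF finite_measure_axioms Gstar Gpl Gh _ \<delta>(1) c\<delta> _ expansion le_abar ca cc])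
      (use measurable_S[OF Gh \<delta>(1) \<delta>1] measurable_N c3 in \<open>auto simp: X\<close>)
  \<comment> \<open>The ground truth is itself a model, hence a competitor of the minimizer.\<close>
  also have "\<dots> \<le> objective Ts r P Gstar Gpl c \<delta> Gstar"
    using minimizer Gs by (auto simp: is_arg_min_def not_less)
  also have "\<dots> \<le> (c + 3) / (c - 1) * Err P Gstar Gpl + (2 * c + 2) / (c - 1) * \<mu> - Err P Gstar Gpl"
  proof -
    have "R_m Ts r P Gstar \<delta> \<le> R_m Ts r P Gstar 0"
      unfolding R_m_def
    proof (rule finite_measure_mono)
      show "{x \<in> space P. x \<notin> S_m (space P) Ts r Gstar \<delta>}
        \<subseteq> {x \<in> space P. x \<notin> S_m (space P) Ts r Gstar 0}"
        using S_m_mono[OF \<delta>(1), of "space P" Gstar Ts r] Gs by (auto simp: models_def)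
      have "space P - S_m X Ts r Gstar 0 \<in> sets P"
        using measurable_S[OF Gs, of 0] by auto
      then show "{x \<in> space P. x \<notin> S_m (space P) Ts r Gstar 0} \<in> sets P"
        by (simp add: X set_diff_eq)
    qed
    also note separable
    finally have "(2 * c + 2) / (c - 1) * R_m Ts r P Gstar \<delta> \<le> (2 * c + 2) / (c - 1) * \<mu>"
      using c3 by (intro mult_left_mono) auto
    then show ?thesis
      by (simp add: objective_def L_m_eq_Err[OF Gstar Gpl])
  qed
  also have "\<dots> = 4 / (c - 1) * Err P Gstar Gpl + (2 * c + 2) / (c - 1) * \<mu>"
  proof -
    \<comment> \<open>The extra 1 cancels the subtracted \<open>Err P Gstar Gpl\<close>.\<close>
    have "(c + 3) / (c - 1) = 4 / (c - 1) + 1"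
      using c3 by (simp add: field_simps)
    then show ?thesis by (simp add: distrib_right)
  qed
  finally show ?thesis .
qed

end
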